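(* Consider positive constants $\ell$ and $r$, a point $\bar x\in\mathbb{R}^n$, and a set-valued mapping $F:\mathbb{R}^n\rightrightarrows\mathbb{R}^n$ with $\mathrm{dom}\,F=\mathbb{B}[\bar x,r]$. Assume that $F$ is upper semicontinuous, has compact convex values, and that for every $x\in\mathbb{B}[\bar x,r]$ and every $\bar y\in F(\bar x)$ there exists $y\in F(x)$ such that $$\langle\bar y-y,x-\bar x\rangle\ge\ell\|x-\bar x\|^2.$$ Then, for each $y\in\mathbb{R}^n$ such that $\mathrm{dist}(y,F(\bar x))\le r\ell$, there is $x\in\mathbb{B}[\bar x,r]$ satisfying $$y\in F(x)\quad\text{and}\quad\|x-\bar x\|\le\frac1\ell\,\mathrm{dist}\big(y,F(\bar x)\big).$$
   Context: $\mathbb{R}^n$ carries the Euclidean inner product $\langle\cdot,\cdot\rangle$ and norm; $\mathbb{B}[u,r]$ is the closed ball; $\mathrm{dist}(y,C)=\inf\{\|y-c\|:c\in C\}$. $\mathrm{dom}\,F=\{x: F(x)\ne\emptyset\}$. Upper semicontinuity of the set-valued mapping $F$ (on its domain): for each $x\in\mathrm{dom}\,F$ and each open set $O\supset F(x)$ there is a neighborhood $U$ of $x$ with $F(u)\subset O$ for all $u\in U$. *)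

theory Defs
  imports "HOL-Analysis.Analysis"
begin

text \<open>A set-valued mapping from \<open>'a\<close> to \<open>'b\<close> is a function into \<^typ>\<open>'b set\<close>, possibly
  with empty values.\<close>

definition sv_dom :: "('a \<Rightarrow> 'b set) \<Rightarrow> 'a set" where
  "sv_dom F = {x. F x \<noteq> {}}"

text \<open>The neighbourhood is taken in the whole space, not relative to the domain; outside the
  domain the inclusion holds trivially.\<close>

definition upper_semicontinuous ::
  "('a::topological_space \<Rightarrow> 'b::topological_space set) \<Rightarrow> bool" where
  "upper_semicontinuous F \<longleftrightarrow>
    (\<forall>x\<in>sv_dom F. \<forall>V. open V \<and> F x \<subseteq> V \<longrightarrow>
      (\<exists>U. open U \<and> x \<in> U \<and> (\<forall>u\<in>U. F u \<subseteq> V)))"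

end

theory Submission
  imports Defs
begin

text \<open>
  The inclusion \<open>y \<in> F x\<close> is solved on the ball of radius \<open>\<rho> = dist(y, F(xbar)) / l\<close> around
  \<open>xbar\<close>, which is exactly the ball in which the conclusion wants \<open>x\<close> to lie. Let \<open>ybar\<close> be
  the point of \<open>F xbar\<close> nearest to \<open>y\<close>, so \<open>\<parallel>y - ybar\<parallel> = l * \<rho>\<close>. For \<open>x\<close> on the boundary
  sphere the monotonicity hypothesis gives \<open>z \<in> F x\<close> with
  \<open>\<langle>z - ybar, x - xbar\<rangle> \<le> - l * \<rho>\<^sup>2\<close>, and replacing \<open>ybar\<close> by \<open>y\<close> costs at most
  \<open>\<parallel>y - ybar\<parallel> * \<rho> = l * \<rho>\<^sup>2\<close> by Cauchy--Schwarz; hence \<open>\<langle>z - y, x - xbar\<rangle> \<le> 0\<close>. So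
  \<open>F - y\<close> has, at every boundary point, a value that does not point out of the ball, and such a
  mapping has a zero (\<open>upper_semicontinuous_inward_attains\<close>). If \<open>\<rho> = 0\<close>, there is no sphere to
  argue on, but then \<open>y\<close> already lies in the closed set \<open>F xbar\<close>.

  That existence result is proved by contradiction. If \<open>y\<close> belongs to no \<open>F x\<close>, then
  each \<open>F x\<close> is strictly separated from \<open>y\<close>, and upper semicontinuity makes each separating
  direction work on a neighbourhood. Directions that separate at the same point form a convex cone,
  so the local choices can be glued to a continuous field \<open>q\<close> with \<open>\<langle>q x, z - y\<rangle> < 0\<close> for all
  \<open>z \<in> F x\<close> (\<open>continuous_separating_field\<close>). By Brouwer's theorem, \<open>q\<close> either vanishes
  somewhere or is at some boundary point a negative multiple of the outer normal
  (\<open>continuous_field_zero_or_inward_normal\<close>). The former contradicts the strict inequality, the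
  latter contradicts the boundary condition.
\<close>

text \<open>A partition of unity without the normalisation: since the condition on the field describes a
  convex cone at each point, the weights need only be nonnegative and not all zero, and truncated
  cones over the balls of a finite subcover suffice.\<close>

lemma continuous_separating_field:
  fixes G :: "'a::metric_space \<Rightarrow> 'b::real_inner set"
  assumes "compact B"
    and sep: "\<And>x. x \<in> B \<Longrightarrow> \<exists>p. \<exists>e>0. \<forall>u\<in>ball x e. \<forall>z\<in>G u. p \<bullet> z < 0"
  shows "\<exists>q. continuous_on B q \<and> (\<forall>x\<in>B. \<forall>z\<in>G x. q x \<bullet> z < 0)"
proof -
  obtain p e where pe: "\<And>x. x \<in> B \<Longrightarrow> e x > 0"
      "\<And>x u z. x \<in> B \<Longrightarrow> u \<in> ball x (e x) \<Longrightarrow> z \<in> G u \<Longrightarrow> p x \<bullet> z < 0"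
    using sep by metis
  have "B \<subseteq> (\<Union>x\<in>B. ball x (e x))"
    using pe(1) by force
  then obtain C where C: "C \<subseteq> B" "finite C" "B \<subseteq> (\<Union>c\<in>C. ball c (e c))"
    using compactE_image[OF \<open>compact B\<close>, of B "\<lambda>x. ball x (e x)"] by (metis open_ball)
  define q where "q x = (\<Sum>c\<in>C. max 0 (e c - dist c x) *\<^sub>R p c)" for x
  have "q x \<bullet> z < 0" if x: "x \<in> B" and z: "z \<in> G x" for x z
  proof -
    obtain c where c: "c \<in> C" "x \<in> ball c (e c)"
      using C x by blast
    have "q x \<bullet> z = (\<Sum>c\<in>C. max 0 (e c - dist c x) * (p c \<bullet> z))"
      by (simp add: q_def inner_sum_left)
    also have "\<dots> < (\<Sum>c\<in>C. 0)"
    proof (rule sum_strict_mono_ex1)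
      show "\<forall>c\<in>C. max 0 (e c - dist c x) * (p c \<bullet> z) \<le> 0"
      proof
        fix c assume "c \<in> C"
        then show "max 0 (e c - dist c x) * (p c \<bullet> z) \<le> 0"
          using pe(2)[of c x z] C(1) z
          by (cases "x \<in> ball c (e c)") (auto simp: mult_le_0_iff less_imp_le)
      qed
      show "\<exists>c\<in>C. max 0 (e c - dist c x) * (p c \<bullet> z) < 0"
        using c pe(2)[of c x z] C(1) z by (intro bexI[of _ c]) (auto simp: mult_less_0_iff)
    qed (use C in auto)
    finally show ?thesis by simp
  qed
  moreover have "continuous_on B q"
    unfolding q_def by (intro continuous_intros)
  ultimately show ?thesis by blast
qed

text \<open>The Hartman--Stampacchia theorem: a fixed point of \<open>x \<mapsto> proj\<^sub>B (x - q x)\<close> satisfies the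
  variational inequality, because the projection onto \<open>B\<close> is characterised by an obtuse angle.\<close>

lemma variational_inequality:
  fixes q :: "'a::euclidean_space \<Rightarrow> 'a"
  assumes "compact B" "convex B" "B \<noteq> {}" "continuous_on B q"
  shows "\<exists>x\<in>B. \<forall>w\<in>B. q x \<bullet> (w - x) \<ge> 0"
proof -
  have cl: "closed B"
    using assms compact_imp_closed by blast
  let ?f = "closest_point B \<circ> (\<lambda>x. x - q x)"
  have "continuous_on B ?f"
    using assms cl by (intro continuous_on_compose continuous_intros continuous_on_closest_point)
  moreover have "?f ` B \<subseteq> B"
    using cl assms closest_point_in_set by fastforce
  ultimately obtain x where x: "x \<in> B" "closest_point B (x - q x) = x"
    using brouwer[OF assms(1-3), of ?f] by (auto simp: image_subset_iff)
  have "q x \<bullet> (w - x) \<ge> 0" if "w \<in> B" for w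
    using closest_point_dot[OF assms(2) cl that, of "x - q x"] x by (simp add: inner_diff_left)
  with x show ?thesis by blast
qed

lemma continuous_field_zero_or_inward_normal:
  fixes q :: "'a::euclidean_space \<Rightarrow> 'a"
  assumes "\<rho> > 0" "continuous_on (cball a \<rho>) q"
  shows "(\<exists>x\<in>cball a \<rho>. q x = 0) \<or> (\<exists>x\<in>sphere a \<rho>. \<exists>t>0. q x = - t *\<^sub>R (x - a))"
proof -
  obtain x where x: "x \<in> cball a \<rho>" and vi: "\<And>w. w \<in> cball a \<rho> \<Longrightarrow> q x \<bullet> (w - x) \<ge> 0"
    using variational_inequality[of "cball a \<rho>" q] assms by auto
  show ?thesis
  proof (cases "q x = 0")
    case False
    let ?n = "norm (q x)"
    have n: "?n > 0" using False by simp
    \<comment> \<open>The point of the ball farthest in direction \<open>- q x\<close>: there the inequality is the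
      reverse of Cauchy--Schwarz, which forces \<open>x\<close> to be that point.\<close>
    let ?w = "a - (\<rho> / ?n) *\<^sub>R q x"
    have "?w \<in> cball a \<rho>"
      using n assms(1) by (simp add: dist_norm)
    from vi[OF this] have "q x \<bullet> (x - a) + (\<rho> / ?n) * (?n * ?n) \<le> 0"
      by (simp add: inner_diff_right dot_square_norm power2_eq_square)
    then have le: "\<rho> * ?n \<le> (- q x) \<bullet> (x - a)"
      using n by simp
    have xa: "norm (x - a) \<le> \<rho>"
      using x by (simp add: dist_norm norm_minus_commute)
    then have "?n * norm (x - a) \<le> \<rho> * ?n"
      using n by (simp add: mult.commute)
    moreover have cs: "(- q x) \<bullet> (x - a) \<le> ?n * norm (x - a)"
      using norm_cauchy_schwarz[of "- q x" "x - a"] by simp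
    ultimately have eqs: "(- q x) \<bullet> (x - a) = ?n * norm (x - a)" "?n * norm (x - a) = \<rho> * ?n"
      using le by linarith+
    then have \<rho>: "norm (x - a) = \<rho>"
      using n by simp
    have "?n *\<^sub>R (x - a) = \<rho> *\<^sub>R (- q x)"
      using norm_cauchy_schwarz_eq[of "- q x" "x - a"] eqs \<rho> by simp
    then have "(1 / \<rho>) *\<^sub>R (?n *\<^sub>R (x - a)) = - q x"
      using assms(1) by simp
    then have "q x = - (?n / \<rho>) *\<^sub>R (x - a)"
      by (metis (no_types) add.inverse_inverse mult.left_neutral scaleR_minus_left scaleR_scaleR
          times_divide_eq_left)
    moreover have "?n / \<rho> > 0" "x \<in> sphere a \<rho>"
      using n assms(1) \<rho> by (auto simp: dist_norm norm_minus_commute)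
    ultimately show ?thesis by blast
  qed (use x in blast)
qed

text \<open>A set-valued Bolzano--Poincare--Miranda principle on a ball. It is enough that one value at each
  boundary point satisfies the boundary inequality, since a separating field has to have a strict
  sign against all of them.\<close>

lemma upper_semicontinuous_inward_attains:
  fixes F :: "'a::euclidean_space \<Rightarrow> 'a set"
  assumes "\<rho> > 0" "cball a \<rho> \<subseteq> sv_dom F" and usc: "upper_semicontinuous F"
    and val: "\<And>x. x \<in> cball a \<rho> \<Longrightarrow> closed (F x) \<and> convex (F x)"
    and inw: "\<And>x. x \<in> sphere a \<rho> \<Longrightarrow> \<exists>z\<in>F x. (z - y) \<bullet> (x - a) \<le> 0"
  shows "\<exists>x\<in>cball a \<rho>. y \<in> F x"
proof (rule ccontr)
  assume "\<not> ?thesis"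
  then have no: "y \<notin> F x" if "x \<in> cball a \<rho>" for x
    using that by blast
  let ?G = "\<lambda>x. (\<lambda>z. z - y) ` F x"
  have "\<exists>p. \<exists>e>0. \<forall>u\<in>ball x e. \<forall>z\<in>?G u. p \<bullet> z < 0" if x: "x \<in> cball a \<rho>" for x
  proof -
    obtain h b where hb: "h \<bullet> y < b" "\<forall>z\<in>F x. b < h \<bullet> z"
      using separating_hyperplane_closed_point[of "F x" y] val[OF x] no[OF x] by blast
    have "open {z. b < h \<bullet> z}" "F x \<subseteq> {z. b < h \<bullet> z}"
      using hb by (auto simp: open_halfspace_gt)
    moreover have "x \<in> sv_dom F"
      using x assms(2) by (rule subsetD[rotated])
    ultimately obtain U where U: "open U" "x \<in> U" "\<forall>u\<in>U. F u \<subseteq> {z. b < h \<bullet> z}"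
      using usc[unfolded upper_semicontinuous_def, rule_format] by metis
    then obtain e where e: "e > 0" "ball x e \<subseteq> U"
      using open_contains_ball by blast
    have "(- h) \<bullet> (z - y) < 0" if "u \<in> ball x e" "z \<in> F u" for u z
    proof -
      have "b < h \<bullet> z" using that e U by blast
      then show ?thesis using hb(1) by (simp add: inner_diff_right)
    qed
    with e(1) show ?thesis by blast
  qed
  then obtain q where q: "continuous_on (cball a \<rho>) q"
      and neg: "\<And>x z. x \<in> cball a \<rho> \<Longrightarrow> z \<in> F x \<Longrightarrow> q x \<bullet> (z - y) < 0"
    using continuous_separating_field[of "cball a \<rho>" ?G] by auto
  from continuous_field_zero_or_inward_normal[OF assms(1) q] show False
  proof (elim disjE bexE exE conjE)
    fix x assume x: "x \<in> cball a \<rho>" "q x = 0"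
    then obtain z where "z \<in> F x"
      using assms(2) unfolding sv_dom_def by blast
    with neg[OF x(1) this] x(2) show False by simp
  next
    fix x t assume x: "x \<in> sphere a \<rho>" and t: "0 < t" "q x = - t *\<^sub>R (x - a)"
    obtain z where z: "z \<in> F x" "(z - y) \<bullet> (x - a) \<le> 0"
      using inw[OF x] by blast
    have "q x \<bullet> (z - y) < 0"
      using neg[of x z] x z(1) by auto
    then have "t * ((z - y) \<bullet> (x - a)) > 0"
      by (simp add: t(2) inner_commute)
    with z(2) t(1) show False
      by (simp add: zero_less_mult_iff)
  qed
qed

theorem corollary3p8:
  fixes l r :: real
    and xbar :: "real ^ 'n"
    and F :: "real ^ 'n \<Rightarrow> (real ^ 'n) set"
  assumes "l > 0" and "r > 0"
    and "sv_dom F = cball xbar r"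
    and "upper_semicontinuous F"
    and "\<And>x. x \<in> sv_dom F \<Longrightarrow> compact (F x) \<and> convex (F x)"
    and "\<And>x ybar. x \<in> cball xbar r \<Longrightarrow> ybar \<in> F xbar \<Longrightarrow>
           \<exists>y\<in>F x. (ybar - y) \<bullet> (x - xbar) \<ge> l * (norm (x - xbar))\<^sup>2"
  shows "\<forall>y. infdist y (F xbar) \<le> r * l \<longrightarrow>
           (\<exists>x\<in>cball xbar r. y \<in> F x \<and> norm (x - xbar) \<le> (1 / l) * infdist y (F xbar))"
proof (intro allI impI)
  fix y assume y: "infdist y (F xbar) \<le> r * l"
  have xbar: "xbar \<in> sv_dom F"
    using assms(2,3) by simp
  then have ne: "F xbar \<noteq> {}" and cl: "closed (F xbar)"
    using assms(5) compact_imp_closed by (auto simp: sv_dom_def)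
  obtain ybar where ybar: "ybar \<in> F xbar" "infdist y (F xbar) = dist y ybar"
    using infdist_attains_inf[OF cl ne] by metis
  define \<rho> where "\<rho> = infdist y (F xbar) / l"
  have \<rho>: "\<rho> \<le> r" "dist y ybar = l * \<rho>"
    using y assms(1) ybar(2) by (auto simp: \<rho>_def field_simps)
  have "\<exists>x\<in>cball xbar \<rho>. y \<in> F x"
  proof (cases "\<rho> > 0")
    case False
    then have "y = ybar"
      using \<rho>(2) assms(1) by (smt (verit) mult_nonneg_nonpos zero_less_dist_iff)
    then have "y \<in> F xbar" "\<rho> = 0"
      using \<rho>(2) assms(1) ybar(1) by auto
    then show ?thesis by simp
  next
    case True
    have sub: "cball xbar \<rho> \<subseteq> sv_dom F"
      unfolding assms(3) by (rule subset_cball[OF \<rho>(1)])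
    show ?thesis
    proof (rule upper_semicontinuous_inward_attains[OF True sub assms(4)])
      show "closed (F x) \<and> convex (F x)" if "x \<in> cball xbar \<rho>" for x
        using assms(5)[OF subsetD[OF sub that]] compact_imp_closed by auto
    next
      fix x assume x: "x \<in> sphere xbar \<rho>"
      then have nx: "norm (x - xbar) = \<rho>" and "x \<in> cball xbar r"
        using \<rho>(1) by (auto simp: dist_norm norm_minus_commute)
      then obtain z where z: "z \<in> F x" "(ybar - z) \<bullet> (x - xbar) \<ge> l * \<rho>\<^sup>2"
        using assms(6)[of x ybar] ybar(1) by auto
      have "(ybar - y) \<bullet> (x - xbar) \<le> norm (ybar - y) * norm (x - xbar)"
        by (rule norm_cauchy_schwarz)
      also have "\<dots> = l * \<rho>\<^sup>2"
        using \<rho>(2) nx by (simp add: dist_norm norm_minus_commute power2_eq_square)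
      finally have "(z - y) \<bullet> (x - xbar) \<le> 0"
        using z(2) by (simp add: inner_diff_left)
      with z(1) show "\<exists>z\<in>F x. (z - y) \<bullet> (x - xbar) \<le> 0" by blast
    qed
  qed
  then obtain x where x: "x \<in> cball xbar \<rho>" "y \<in> F x"
    by blast
  then have "x \<in> cball xbar r" "norm (x - xbar) \<le> (1 / l) * infdist y (F xbar)"
    using \<rho>(1) by (auto simp: \<rho>_def dist_norm norm_minus_commute)
  with x(2) show "\<exists>x\<in>cball xbar r. y \<in> F x \<and> norm (x - xbar) \<le> (1 / l) * infdist y (F xbar)"
    by blast
qed

end
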